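(* Let $\tau\in\mathbb{C}$ with $\operatorname{Im}\tau>0$, $q=e^{2\pi i\tau}$, and $a,b\in\mathbb{R}$. Then, as an identity of meromorphic functions of $(u,v)\in\mathbb{C}^2$, $$\Theta_{trap}\!\left[{a\atop b}\right](3\tau|3u,-3v)=-e^{-2\pi i a/3}\,e^{6\pi i v}\;\Theta_{trap}\!\left[{-a\atop -b}\right](3\tau|3(\tau-u),3v).$$
   Context: For real $s$ write $q^s=e^{2\pi i\tau s}$. The trapezoid (Appell-type) function is the meromorphic function $$\Theta_{trap}\!\left[{a\atop b}\right](3\tau|3u,3v)=e^{2\pi i v b}\sum_{n\in\mathbb{Z}}\frac{q^{\frac16(a+3n)(a+2b+3n)}\,e^{2\pi i(a+3n)(u-1/6)}}{1-q^{a+3n}e^{6\pi i v}}.$$ *)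

theory Defs
  imports "HOL-Analysis.Analysis"
begin

text \<open>
  Holomorphic and meromorphic functions of two complex variables.  The set \<open>D\<close> is meant
  to be open, and holomorphy is complex differentiability (existence of a complex-linear total
  derivative) at every point.  A meromorphic function is locally a quotient \<open>g / h\<close> of
  holomorphic functions whose denominator does not vanish identically on the connected
  neighbourhood \<open>W\<close>; its values on the zero set of \<open>h\<close> (poles and points of
  indeterminacy) are not constrained.
\<close>

definition holomorphic2_on ::
    "(complex \<times> complex \<Rightarrow> complex) \<Rightarrow> (complex \<times> complex) set \<Rightarrow> bool" where
  "holomorphic2_on f D \<longleftrightarrow>
     (\<forall>p\<in>D. \<exists>A B. (f has_derivative (\<lambda>(h, k). A * h + B * k)) (at p))"

definition meromorphic2_on ::
    "(complex \<times> complex \<Rightarrow> complex) \<Rightarrow> (complex \<times> complex) set \<Rightarrow> bool" where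
  "meromorphic2_on f D \<longleftrightarrow>
     (\<forall>p\<in>D. \<exists>W g h. open W \<and> connected W \<and> p \<in> W \<and> W \<subseteq> D \<and>
        holomorphic2_on g W \<and> holomorphic2_on h W \<and> (\<exists>z\<in>W. h z \<noteq> 0) \<and>
        (\<forall>z\<in>W. h z \<noteq> 0 \<longrightarrow> f z = g z / h z))"

definition qpow :: "complex \<Rightarrow> real \<Rightarrow> complex" where
  "qpow \<tau> s = exp (2 * pi * \<i> * \<tau> * s)"

definition trap_denom :: "real \<Rightarrow> complex \<Rightarrow> complex \<Rightarrow> int \<Rightarrow> complex" where
  "trap_denom a \<tau> v n = 1 - qpow \<tau> (a + 3 * n) * exp (6 * pi * \<i> * v)"

definition trap_term ::
    "real \<Rightarrow> real \<Rightarrow> complex \<Rightarrow> complex \<Rightarrow> complex \<Rightarrow> int \<Rightarrow> complex" where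
  "trap_term a b \<tau> u v n =
     qpow \<tau> (1 / 6 * (a + 3 * n) * (a + 2 * b + 3 * n)) *
     exp (2 * pi * \<i> * (a + 3 * n) * (u - 1 / 6)) / trap_denom a \<tau> v n"

text \<open>
  The defining formula is given for the arguments \<open>(3\<tau> | 3u, 3v)\<close>, so the function of
  \<open>(T | U, V)\<close> is the formula at \<open>\<tau> = T/3\<close>, \<open>u = U/3\<close>, \<open>v = V/3\<close>.
  The sum has its intended meaning only where no \<open>trap_denom\<close> vanishes.
\<close>

definition theta_trap ::
    "real \<Rightarrow> real \<Rightarrow> complex \<Rightarrow> complex \<Rightarrow> complex \<Rightarrow> complex" where
  "theta_trap a b T U V =
     (let \<tau> = T / 3; u = U / 3; v = V / 3
      in exp (2 * pi * \<i> * v * b) * (\<Sum>\<^sub>\<infinity>n\<in>UNIV. trap_term a b \<tau> u v n))"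

end

(*
  Substituting n -> -n turns each summand on the right into one on the left: with x = a + 3n and
  E = exp(6 pi i v),  q^(-x) / (1 - q^(-x) E) = - E^(-1) / (1 - q^x E^(-1)),  and the two shifts by
  -1/6 leave the factor exp(2 pi i x / 3) = exp(2 pi i a / 3), which is independent of n.

  For the meromorphy, near a given point all but finitely many w = q^x E satisfy |log|w|| >= 1, so
  that |1 - w| is bounded below by 1/2 and |w|/2.  The corresponding summands and their partial
  derivatives are dominated by a Gaussian in n, so they sum to a holomorphic function; the product
  of the remaining finitely many denominators serves as a local denominator.
*)
theory Submission
  imports Defs
begin

subsection \<open>Holomorphic and meromorphic functions of two variables\<close>

lemma holomorphic2_onI:
  assumes "\<And>p. p \<in> D \<Longrightarrow> (f has_derivative (\<lambda>(h, k). A p * h + B p * k)) (at p)"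
  shows "holomorphic2_on f D"
  using assms unfolding holomorphic2_on_def by blast

lemma holomorphic2_on_const: "holomorphic2_on (\<lambda>z. c) D"
  by (rule holomorphic2_onI[where A = "\<lambda>_. 0" and B = "\<lambda>_. 0"]) (simp add: case_prod_unfold)

lemma holomorphic2_on_mult:
  assumes "holomorphic2_on f D" "holomorphic2_on g D"
  shows "holomorphic2_on (\<lambda>z. f z * g z) D"
  unfolding holomorphic2_on_def
proof
  fix p assume p: "p \<in> D"
  obtain A B where f: "(f has_derivative (\<lambda>(h, k). A * h + B * k)) (at p)"
    using assms(1) p unfolding holomorphic2_on_def by blast
  obtain A' B' where g: "(g has_derivative (\<lambda>(h, k). A' * h + B' * k)) (at p)"
    using assms(2) p unfolding holomorphic2_on_def by blast
  have "((\<lambda>z. f z * g z) has_derivative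
          (\<lambda>(h, k). (f p * A' + A * g p) * h + (f p * B' + B * g p) * k)) (at p)"
    using has_derivative_mult[OF f g]
    by (rule has_derivative_eq_rhs) (auto simp: fun_eq_iff algebra_simps)
  then show "\<exists>A B. ((\<lambda>z. f z * g z) has_derivative (\<lambda>(h, k). A * h + B * k)) (at p)"
    by blast
qed

lemma holomorphic2_on_add:
  assumes "holomorphic2_on f D" "holomorphic2_on g D"
  shows "holomorphic2_on (\<lambda>z. f z + g z) D"
  unfolding holomorphic2_on_def
proof
  fix p assume p: "p \<in> D"
  obtain A B where f: "(f has_derivative (\<lambda>(h, k). A * h + B * k)) (at p)"
    using assms(1) p unfolding holomorphic2_on_def by blast
  obtain A' B' where g: "(g has_derivative (\<lambda>(h, k). A' * h + B' * k)) (at p)"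
    using assms(2) p unfolding holomorphic2_on_def by blast
  have "((\<lambda>z. f z + g z) has_derivative (\<lambda>(h, k). (A + A') * h + (B + B') * k)) (at p)"
    using has_derivative_add[OF f g]
    by (rule has_derivative_eq_rhs) (auto simp: fun_eq_iff algebra_simps)
  then show "\<exists>A B. ((\<lambda>z. f z + g z) has_derivative (\<lambda>(h, k). A * h + B * k)) (at p)"
    by blast
qed

lemma holomorphic2_on_sum:
  assumes "\<And>i. i \<in> I \<Longrightarrow> holomorphic2_on (f i) D"
  shows "holomorphic2_on (\<lambda>z. \<Sum>i\<in>I. f i z) D"
  using assms
  by (induction I rule: infinite_finite_induct)
    (auto intro: holomorphic2_on_const holomorphic2_on_add)

lemma holomorphic2_on_prod:
  assumes "\<And>i. i \<in> I \<Longrightarrow> holomorphic2_on (f i) D"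
  shows "holomorphic2_on (\<lambda>z. \<Prod>i\<in>I. f i z) D"
  using assms
  by (induction I rule: infinite_finite_induct)
    (auto intro: holomorphic2_on_const holomorphic2_on_mult)

text \<open>Termwise differentiation by the Weierstrass M-test: the single majorant \<open>M\<close>
  controls the values and both partial derivatives, so the series of derivatives converge uniformly
  on \<open>W\<close>. Convexity of \<open>W\<close> lets uniform convergence of the derivatives
  pass to the limit function.\<close>

lemma holomorphic2_on_infsum:
  fixes f :: "int \<Rightarrow> complex \<times> complex \<Rightarrow> complex"
  assumes W: "open W" "convex W"
    and f: "\<And>n z. z \<in> W \<Longrightarrow> (f n has_derivative (\<lambda>(h, k). A n z * h + B n z * k)) (at z)"
    and fM: "\<And>n z. z \<in> W \<Longrightarrow> norm (f n z) \<le> M n"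
    and AM: "\<And>n z. z \<in> W \<Longrightarrow> norm (A n z) \<le> M n"
    and BM: "\<And>n z. z \<in> W \<Longrightarrow> norm (B n z) \<le> M n"
    and M: "M summable_on UNIV"
  shows "holomorphic2_on (\<lambda>z. \<Sum>\<^sub>\<infinity>n. f n z) W"
proof (cases "W = {}")
  case True
  then show ?thesis by (simp add: holomorphic2_on_def)
next
  case False
  then obtain z0 where z0: "z0 \<in> W" by blast
  \<comment> \<open>The theorems on differentiating series concern sequences, so the sum over the
    integers is enumerated by \<open>int_decode\<close>; absolute convergence makes the order
    irrelevant.\<close>
  let ?d = int_decode
  have bij: "bij_betw ?d UNIV UNIV" by (rule bij_int_decode)
  have sM: "summable (\<lambda>k. M (?d k))"
    using M summable_on_reindex_bij_betw[OF bij, of M] by (auto intro: summable_on_imp_summable)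
  have sums: "(\<lambda>k. f (?d k) z) sums (\<Sum>\<^sub>\<infinity>n. f n z)" if z: "z \<in> W" for z
  proof -
    have "(\<lambda>n. f n z) summable_on UNIV"
      by (rule abs_summable_summable, rule summable_on_comparison_test[OF M])
        (use fM z in auto)
    then have "((\<lambda>k. f (?d k) z) has_sum (\<Sum>\<^sub>\<infinity>n. f n z)) UNIV"
      using has_sum_reindex_bij_betw[OF bij, of "\<lambda>n. f n z"] by (simp add: has_sum_infsum)
    then show ?thesis by (rule has_sum_imp_sums)
  qed
  define A' where "A' z = (\<Sum>k. A (?d k) z)" for z
  define B' where "B' z = (\<Sum>k. B (?d k) z)" for z
  have uA: "uniform_limit W (\<lambda>n z. \<Sum>k<n. A (?d k) z) A' sequentially"
    unfolding A'_def by (rule Weierstrass_m_test[OF _ sM]) (use AM in auto)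
  have uB: "uniform_limit W (\<lambda>n z. \<Sum>k<n. B (?d k) z) B' sequentially"
    unfolding B'_def by (rule Weierstrass_m_test[OF _ sM]) (use BM in auto)
  have "\<exists>g. \<forall>z\<in>W. (\<lambda>k. f (?d k) z) sums g z \<and>
          (g has_derivative (\<lambda>(h, k). A' z * h + B' z * k)) (at z within W)"
  proof (rule has_derivative_series[where f = "\<lambda>k. f (?d k)" and g' = "\<lambda>z (h, k). A' z * h + B' z * k"
        and f' = "\<lambda>i z (h, k). A (?d i) z * h + B (?d i) z * k",
        OF W(2) _ _ z0 sums[OF z0]])
    show "(f (?d n) has_derivative (\<lambda>(h, k). A (?d n) z * h + B (?d n) z * k)) (at z within W)"
      if "z \<in> W" for n z
      using f[OF that] has_derivative_at_withinI by blast
    fix e :: real assume e: "e > 0"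
    \<comment> \<open>Each coordinate of \<open>h\<close> has norm at most \<open>norm h\<close>, so
      an error of \<open>e / 2\<close> in each partial derivative gives the operator bound
      \<open>e * norm h\<close>.\<close>
    have "\<forall>\<^sub>F n in sequentially. \<forall>z\<in>W. dist (\<Sum>k<n. A (?d k) z) (A' z) < e / 2"
      "\<forall>\<^sub>F n in sequentially. \<forall>z\<in>W. dist (\<Sum>k<n. B (?d k) z) (B' z) < e / 2"
      using uA uB e unfolding uniform_limit_iff by (meson half_gt_zero)+
    then show "\<forall>\<^sub>F n in sequentially. \<forall>z\<in>W. \<forall>h.
      norm ((\<Sum>i<n. case h of (h, k) \<Rightarrow> A (?d i) z * h + B (?d i) z * k) -
            (case h of (h, k) \<Rightarrow> A' z * h + B' z * k)) \<le> e * norm h"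
    proof eventually_elim
      case (elim n)
      show ?case
      proof (intro ballI allI)
        fix z and h :: "complex \<times> complex" assume z: "z \<in> W"
        obtain x y where h: "h = (x, y)" by (cases h)
        let ?a = "(\<Sum>k<n. A (?d k) z) - A' z" and ?b = "(\<Sum>k<n. B (?d k) z) - B' z"
        have "norm (?a * x + ?b * y) \<le> norm ?a * norm x + norm ?b * norm y"
          by (metis norm_mult norm_triangle_ineq)
        also have "\<dots> \<le> e / 2 * norm h + e / 2 * norm h"
          using e elim z norm_fst_le[of x y] norm_snd_le[of y x] unfolding h dist_norm
          by (intro add_mono mult_mono) (auto intro: less_imp_le)
        finally show "norm ((\<Sum>i<n. case h of (h, k) \<Rightarrow> A (?d i) z * h + B (?d i) z * k) -
            (case h of (h, k) \<Rightarrow> A' z * h + B' z * k)) \<le> e * norm h"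
          by (simp add: h sum.distrib left_diff_distrib add_diff_add flip: sum_distrib_right)
      qed
    qed
  qed
  then obtain g where g: "\<And>z. z \<in> W \<Longrightarrow> (\<lambda>k. f (?d k) z) sums g z"
    and dg: "\<And>z. z \<in> W \<Longrightarrow> (g has_derivative (\<lambda>(h, k). A' z * h + B' z * k)) (at z within W)"
    by blast
  have eq: "g z = (\<Sum>\<^sub>\<infinity>n. f n z)" if "z \<in> W" for z
    using g[OF that] sums[OF that] sums_unique2 by blast
  show ?thesis
  proof (rule holomorphic2_onI)
    fix z assume z: "z \<in> W"
    have "(g has_derivative (\<lambda>(h, k). A' z * h + B' z * k)) (at z)"
      using dg[OF z] at_within_open[OF z W(1)] by simp
    then show "((\<lambda>z. \<Sum>\<^sub>\<infinity>n. f n z) has_derivative (\<lambda>(h, k). A' z * h + B' z * k)) (at z)"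
      by (rule has_derivative_transform_within_open[OF _ W(1) z]) (rule eq)
  qed
qed

section \<open>Affine substitutions and multiplication by entire functions\<close>

lemma holomorphic2_on_affine:
  assumes f: "holomorphic2_on f D"
  shows "holomorphic2_on (\<lambda>(u, v). f (c + s * u, d + t * v)) ((\<lambda>(u, v). (c + s * u, d + t * v)) -` D)"
  unfolding holomorphic2_on_def
proof
  let ?L = "\<lambda>(u, v). (c + s * u, d + t * v)"
  fix p assume "p \<in> ?L -` D"
  then obtain A B where f': "(f has_derivative (\<lambda>(h, k). A * h + B * k)) (at (?L p))"
    using f unfolding holomorphic2_on_def by blast
  have "(?L has_derivative (\<lambda>(h, k). (s * h, t * k))) (at p)"
    unfolding case_prod_unfold by (auto intro!: derivative_eq_intros)
  from has_derivative_compose[OF this f']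
  have "((\<lambda>z. f (?L z)) has_derivative (\<lambda>(h, k). (A * s) * h + (B * t) * k)) (at p)"
    by (rule has_derivative_eq_rhs) (auto simp: fun_eq_iff)
  then show "\<exists>A B. ((\<lambda>(u, v). f (c + s * u, d + t * v)) has_derivative
      (\<lambda>(h, k). A * h + B * k)) (at p)"
    by (auto simp: case_prod_unfold)
qed

lemma meromorphic2_onE:
  assumes "meromorphic2_on f D" "p \<in> D"
  obtains W g h where "open W" "connected W" "p \<in> W"
    "holomorphic2_on g W" "holomorphic2_on h W" "\<exists>z\<in>W. h z \<noteq> 0"
    "\<And>z. z \<in> W \<Longrightarrow> h z \<noteq> 0 \<Longrightarrow> f z = g z / h z"
  using assms(1)[unfolded meromorphic2_on_def, THEN bspec, OF assms(2)]
proof (elim exE conjE)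
  fix W g h
  assume "open W" "connected W" "p \<in> W" "holomorphic2_on g W" "holomorphic2_on h W" "\<exists>z\<in>W. h z \<noteq> 0"
    "\<forall>z\<in>W. h z \<noteq> 0 \<longrightarrow> f z = g z / h z"
  then show thesis by (intro that[of W g h]) simp_all
qed

text \<open>Serves the substitutions v -> -v and u -> tau - u. Since \<open>s\<close> and
  \<open>t\<close> are nonzero, the map is a homeomorphism, so the pulled-back neighbourhood is
  connected and the pulled-back denominator still has a point where it does not vanish.\<close>

lemma meromorphic2_on_affine:
  assumes f: "meromorphic2_on f UNIV" and "s \<noteq> 0" "t \<noteq> 0"
  shows "meromorphic2_on (\<lambda>(u, v). f (c + s * u, d + t * v)) UNIV"
  unfolding meromorphic2_on_def
proof
  let ?L = "\<lambda>(u, v). (c + s * u, d + t * v)"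
  let ?K = "\<lambda>(u, v). ((u - c) / s, (v - d) / t)"
  fix p :: "complex \<times> complex"
  obtain W g h where W: "open W" "connected W" "?L p \<in> W"
    and g: "holomorphic2_on g W" and h: "holomorphic2_on h W" "\<exists>z\<in>W. h z \<noteq> 0"
    and eq: "\<And>z. z \<in> W \<Longrightarrow> h z \<noteq> 0 \<Longrightarrow> f z = g z / h z"
    by (rule meromorphic2_onE[OF f, of "?L p"]) (simp, rule that)
  let ?f = "\<lambda>(u, v). f (c + s * u, d + t * v)"
  let ?g = "\<lambda>(u, v). g (c + s * u, d + t * v)"
  let ?h = "\<lambda>(u, v). h (c + s * u, d + t * v)"
  have LK: "?L (?K z) = z" and KL: "?K (?L z) = z" for z
    using assms(2,3) by (auto simp: case_prod_unfold)
  have "open (?L -` W)"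
    using W(1) by (rule open_vimage) (unfold case_prod_unfold, intro continuous_intros)
  moreover have "connected (?L -` W)"
  proof -
    \<comment> \<open>Connectedness is preserved by continuous images but not by preimages, hence
      the rewriting through the inverse map.\<close>
    have "?L -` W = ?K ` W"
    proof (intro equalityI subsetI)
      fix z assume "z \<in> ?L -` W"
      then show "z \<in> ?K ` W" using KL[of z] by (intro rev_image_eqI[of "?L z"]) auto
    next
      fix z assume "z \<in> ?K ` W"
      then obtain w where w: "w \<in> W" "z = ?K w" by blast
      show "z \<in> ?L -` W" unfolding vimage_eq w(2) LK by (rule w(1))
    qed
    moreover have "continuous_on W ?K"
      using assms(2,3) by (auto simp: case_prod_unfold intro!: continuous_intros)
    ultimately show ?thesis using W(2) by (simp add: connected_continuous_image)
  qed
  moreover have "\<exists>z\<in>?L -` W. ?h z \<noteq> 0"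
  proof -
    obtain z where z: "z \<in> W" "h z \<noteq> 0" using h(2) by blast
    then show ?thesis
      using LK[of z] by (intro bexI[of _ "?K z"]) (auto simp: case_prod_unfold)
  qed
  moreover have "p \<in> ?L -` W" using W(3) by simp
  moreover have "\<forall>z\<in>?L -` W. ?h z \<noteq> 0 \<longrightarrow> ?f z = ?g z / ?h z"
    unfolding case_prod_unfold by (simp add: eq)
  moreover have "holomorphic2_on ?g (?L -` W)" "holomorphic2_on ?h (?L -` W)"
    by (rule holomorphic2_on_affine, fact)+
  ultimately show "\<exists>W g h. open W \<and> connected W \<and> p \<in> W \<and> W \<subseteq> UNIV \<and>
        holomorphic2_on g W \<and> holomorphic2_on h W \<and> (\<exists>z\<in>W. h z \<noteq> 0) \<and>
        (\<forall>z\<in>W. h z \<noteq> 0 \<longrightarrow> ?f z = g z / h z)"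
    by - (rule exI[of _ "?L -` W"], rule exI[of _ ?g], rule exI[of _ ?h], intro conjI subset_UNIV)
qed

lemma meromorphic2_on_mult_holomorphic:
  assumes "holomorphic2_on k UNIV" "meromorphic2_on f UNIV"
  shows "meromorphic2_on (\<lambda>z. k z * f z) UNIV"
  unfolding meromorphic2_on_def
proof
  fix p :: "complex \<times> complex"
  obtain W g h where W: "open W" "connected W" "p \<in> W"
    and g: "holomorphic2_on g W" and h: "holomorphic2_on h W" "\<exists>z\<in>W. h z \<noteq> 0"
    and eq: "\<And>z. z \<in> W \<Longrightarrow> h z \<noteq> 0 \<Longrightarrow> f z = g z / h z"
    by (rule meromorphic2_onE[OF assms(2), of p]) (simp, rule that)
  have "holomorphic2_on k W" using assms(1) by (auto simp: holomorphic2_on_def)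
  then have "holomorphic2_on (\<lambda>z. k z * g z) W" using g by (rule holomorphic2_on_mult)
  with W h eq show "\<exists>W g h. open W \<and> connected W \<and> p \<in> W \<and> W \<subseteq> UNIV \<and>
        holomorphic2_on g W \<and> holomorphic2_on h W \<and> (\<exists>z\<in>W. h z \<noteq> 0) \<and>
        (\<forall>z\<in>W. h z \<noteq> 0 \<longrightarrow> k z * f z = g z / h z)"
    by - (rule exI[of _ W], rule exI[of _ "\<lambda>z. k z * g z"], rule exI[of _ h], simp)
qed

lemma has_derivative_exp_complex [derivative_intros]:
  fixes g :: "'a::real_normed_vector \<Rightarrow> complex"
  assumes "(g has_derivative g') (at z within S)"
  shows "((\<lambda>z. exp (g z)) has_derivative (\<lambda>h. exp (g z) * g' h)) (at z within S)"
  using has_derivative_compose[OF assms DERIV_exp[unfolded has_field_derivative_def]] .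

lemma holomorphic2_on_exp_snd: "holomorphic2_on (\<lambda>(u, v). exp (c * v)) D"
  by (rule holomorphic2_onI[where A = "\<lambda>_. 0" and B = "\<lambda>z. c * exp (c * snd z)"])
    (auto simp: case_prod_unfold intro!: has_derivative_eq_rhs[OF has_derivative_exp_complex] derivative_intros)

subsection \<open>Estimates for the summands\<close>

lemma summable_exp_neg_abs_int: "(\<lambda>n::int. exp (- \<bar>real_of_int n\<bar>)) summable_on UNIV"
proof -
  have "summable (\<lambda>n. exp (-1 :: real) ^ n)" by (rule summable_geometric) simp
  then have nat: "(\<lambda>n::nat. exp (- real n)) summable_on UNIV"
    by (intro norm_summable_imp_summable_on) (simp add: exp_of_nat_mult[symmetric])
  have "(\<lambda>n. exp (- \<bar>real_of_int n\<bar>)) summable_on range int"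
    by (subst summable_on_reindex) (use nat in \<open>auto simp: o_def\<close>)
  moreover have "(\<lambda>n. exp (- \<bar>real_of_int n\<bar>)) summable_on range (\<lambda>n. - int n)"
    by (subst summable_on_reindex) (use nat in \<open>auto simp: o_def inj_on_def\<close>)
  ultimately have "(\<lambda>n. exp (- \<bar>real_of_int n\<bar>)) summable_on (range int \<union> range (\<lambda>n. - int n))"
    by (rule summable_on_union)
  moreover have "range int \<union> range (\<lambda>n. - int n) = UNIV"
    by (auto intro: int_cases2)
  ultimately show ?thesis by simp
qed

text \<open>Completing the square shows that the Gaussian absorbs every linear exponent. The weight
  \<open>1 + \<bar>a + 3 * n\<bar>\<close> is carried along because differentiating a summand in u
  produces the factor a + 3n.\<close>

lemma gaussian_le_exp_neg_abs:
  fixes a c d :: real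
  assumes "c > 0"
  obtains K where "K \<ge> 0" "\<And>n::int. (1 + \<bar>a + 3 * real_of_int n\<bar>) * exp (- c * (a + 3 * real_of_int n)\<^sup>2 + d * \<bar>a + 3 * real_of_int n\<bar>)
     \<le> K * exp (- \<bar>real_of_int n\<bar>)"
proof (rule that)
  \<comment> \<open>Of the two extra units in the exponent, one pays for 1 + y <= exp y and the
    other leaves the decay exp (-y), which becomes decay in n.\<close>
  let ?e = "d + 2"
  let ?K = "exp (?e\<^sup>2 / (4 * c) + \<bar>a\<bar>)"
  show "?K \<ge> 0" by simp
  fix n :: int
  define y where "y = \<bar>a + 3 * real_of_int n\<bar>"
  have "0 \<le> c * (y - ?e / (2 * c))\<^sup>2" using assms by simp
  also have "\<dots> = c * y\<^sup>2 - ?e * y + ?e\<^sup>2 / (4 * c)"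
    using assms by (simp add: power2_eq_square field_simps)
  finally have 1: "- c * y\<^sup>2 + d * y + y \<le> ?e\<^sup>2 / (4 * c) - y" by (simp add: algebra_simps)
  have 2: "\<bar>real_of_int n\<bar> \<le> y + \<bar>a\<bar>" unfolding y_def by linarith
  have "(1 + y) * exp (- c * y\<^sup>2 + d * y) \<le> exp y * exp (- c * y\<^sup>2 + d * y)"
    by (intro mult_right_mono) (auto simp: exp_ge_add_one_self)
  also have "\<dots> = exp (- c * y\<^sup>2 + d * y + y)" by (simp add: exp_add mult.commute)
  also have "\<dots> \<le> exp (?e\<^sup>2 / (4 * c) + \<bar>a\<bar> + - \<bar>real_of_int n\<bar>)"
    using 1 2 by simp
  also have "\<dots> = ?K * exp (- \<bar>real_of_int n\<bar>)" by (rule exp_add)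
  finally show "(1 + \<bar>a + 3 * real_of_int n\<bar>) * exp (- c * (a + 3 * real_of_int n)\<^sup>2 + d * \<bar>a + 3 * real_of_int n\<bar>)
     \<le> ?K * exp (- \<bar>real_of_int n\<bar>)"
    by (simp add: y_def)
qed

lemma norm_qpow: "norm (qpow \<tau> s) = exp (- 2 * pi * Im \<tau> * s)"
  by (simp add: qpow_def)

lemma norm_qpow_mult_exp:
  "norm (qpow \<tau> s * exp (6 * pi * \<i> * v)) = exp (- (2 * pi * Im \<tau> * s + 6 * pi * Im v))"
  by (simp add: norm_mult norm_qpow flip: exp_add)

text \<open>The estimate exp t >= 1 + t forces |w| >= 2 or |w| <= 1/2, and the reverse triangle
  inequality finishes both cases. The first bound controls 1/(1 - w), the second controls w/(1 - w),
  which appears in the v-derivative.\<close>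

lemma norm_one_minus_lower_bound:
  assumes w: "norm (w :: complex) = exp s" and s: "\<bar>s\<bar> \<ge> 1"
  shows "1 / 2 \<le> norm (1 - w)" "norm w / 2 \<le> norm (1 - w)"
proof -
  have 1: "norm w - 1 \<le> norm (1 - w)" "1 - norm w \<le> norm (1 - w)"
    using norm_triangle_ineq2[of w 1] norm_triangle_ineq2[of 1 w] by (auto simp: norm_minus_commute)
  have "norm w \<ge> 2 \<or> norm w \<le> 1 / 2"
  proof (cases "s \<ge> 1")
    case True
    then show ?thesis using exp_ge_add_one_self[of s] w by linarith
  next
    case False
    then have "exp (- s) \<ge> 2" using exp_ge_add_one_self[of "- s"] s by linarith
    then show ?thesis using w by (simp add: exp_minus field_simps)
  qed
  then show "1 / 2 \<le> norm (1 - w)" "norm w / 2 \<le> norm (1 - w)"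
    using 1 by linarith+
qed

section \<open>Bounds for numerators and denominators, and convergence of the sum\<close>

definition trap_numer ::
    "real \<Rightarrow> real \<Rightarrow> complex \<Rightarrow> complex \<Rightarrow> int \<Rightarrow> complex" where
  "trap_numer a b \<tau> u n =
     qpow \<tau> (1 / 6 * (a + 3 * n) * (a + 2 * b + 3 * n)) * exp (2 * pi * \<i> * (a + 3 * n) * (u - 1 / 6))"

lemma trap_term_eq: "trap_term a b \<tau> u v n = trap_numer a b \<tau> u n / trap_denom a \<tau> v n"
  by (simp add: trap_term_def trap_numer_def)

text \<open>The quadratic exponent has negative real leading coefficient in modulus because Im tau >
  0; the remaining terms are linear in n and bounded uniformly for |u| <= R, so one \<open>K\<close>
  serves the whole disc.\<close>

lemma trap_numer_bound:
  fixes a :: real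
  assumes \<tau>: "Im \<tau> > 0"
  obtains K where "K \<ge> 0" "\<And>u n. norm u \<le> R \<Longrightarrow>
    (1 + \<bar>a + 3 * real_of_int n\<bar>) * norm (trap_numer a b \<tau> u n) \<le> K * exp (- \<bar>real_of_int n\<bar>)"
proof -
  \<comment> \<open>With x = a + 3n the modulus of the numerator is exp (-c x^2 - 2 c b x - 2 pi x
    Im u); \<open>d\<close> below bounds the coefficient of the linear part. The real shift 1/6 only
    affects the phase.\<close>
  define c where "c = pi * Im \<tau> / 3"
  have c: "c > 0" using \<tau> by (simp add: c_def)
  define d where "d = 2 * c * \<bar>b\<bar> + 2 * pi * R"
  obtain K where K: "K \<ge> 0" "\<And>n::int. (1 + \<bar>a + 3 * real_of_int n\<bar>) * exp (- c * (a + 3 * real_of_int n)\<^sup>2 + d * \<bar>a + 3 * real_of_int n\<bar>)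
     \<le> K * exp (- \<bar>real_of_int n\<bar>)"
    by (rule gaussian_le_exp_neg_abs[OF c, of a d]) (rule that)
  show ?thesis
  proof (rule that[OF K(1)])
    fix u :: complex and n :: int assume u: "norm u \<le> R"
    define x where "x = a + 3 * real_of_int n"
    have e: "exp (2 * pi * \<i> * (a + 3 * n) * (u - 1 / 6)) = exp (of_real (2 * pi * x) * (\<i> * (u - 1 / 6)))"
      by (simp add: x_def algebra_simps)
    have "norm (trap_numer a b \<tau> u n) =
        exp (- 2 * pi * Im \<tau> * (1 / 6 * x * (x + 2 * b)) + - (2 * pi * x) * Im u)"
      unfolding trap_numer_def e norm_mult norm_qpow norm_exp_eq_Re exp_add
      by (simp add: x_def algebra_simps)
    also have "\<dots> \<le> exp (- c * x\<^sup>2 + d * \<bar>x\<bar>)"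
    proof -
      have "- (b * x) \<le> \<bar>b\<bar> * \<bar>x\<bar>" by (metis abs_ge_minus_self abs_mult)
      then have "2 * c * (- (b * x)) \<le> 2 * c * (\<bar>b\<bar> * \<bar>x\<bar>)" using c by (intro mult_left_mono) auto
      moreover have "- (x * Im u) \<le> \<bar>x\<bar> * \<bar>Im u\<bar>" by (metis abs_ge_minus_self abs_mult)
      then have "- (x * Im u) \<le> \<bar>x\<bar> * R"
        using abs_Im_le_cmod[of u] u mult_left_mono[of "\<bar>Im u\<bar>" R "\<bar>x\<bar>"] by linarith
      then have "2 * pi * (- (x * Im u)) \<le> 2 * pi * (\<bar>x\<bar> * R)" by (intro mult_left_mono) auto
      ultimately show ?thesis
        by (simp add: c_def d_def power2_eq_square field_simps)
    qed
    finally have "(1 + \<bar>x\<bar>) * norm (trap_numer a b \<tau> u n) \<le> (1 + \<bar>x\<bar>) * exp (- c * x\<^sup>2 + d * \<bar>x\<bar>)"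
      by (intro mult_left_mono) auto
    with K(2)[of n] show "(1 + \<bar>a + 3 * real_of_int n\<bar>) * norm (trap_numer a b \<tau> u n) \<le> K * exp (- \<bar>real_of_int n\<bar>)"
      by (simp add: x_def)
  qed
qed

text \<open>The indices for which the denominator may be small somewhere in the region \<open>\<bar>v\<bar> \<le> R\<close>.\<close>

definition trap_small :: "real \<Rightarrow> complex \<Rightarrow> real \<Rightarrow> int set" where
  "trap_small a \<tau> R = {n. 2 * pi * Im \<tau> * \<bar>a + 3 * real_of_int n\<bar> < 6 * pi * R + 1}"

lemma finite_trap_small:
  assumes "Im \<tau> > 0"
  shows "finite (trap_small a \<tau> R)"
proof -
  define C where "C = (6 * pi * R + 1) / (2 * pi * Im \<tau>)"
  have "trap_small a \<tau> R \<subseteq> {- \<lceil>\<bar>C\<bar> + \<bar>a\<bar>\<rceil> .. \<lceil>\<bar>C\<bar> + \<bar>a\<bar>\<rceil>}"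
  proof
    fix n assume "n \<in> trap_small a \<tau> R"
    then have "\<bar>a + 3 * real_of_int n\<bar> < C"
      using assms by (simp add: trap_small_def C_def field_simps)
    then show "n \<in> {- \<lceil>\<bar>C\<bar> + \<bar>a\<bar>\<rceil> .. \<lceil>\<bar>C\<bar> + \<bar>a\<bar>\<rceil>}" by simp linarith
  qed
  then show ?thesis by (rule finite_subset) simp
qed

text \<open>Here w = q^(a+3n) exp(6 pi i v) has log |w| = -(2 pi Im tau (a + 3n) + 6 pi Im v). The
  second term is at most 6 pi R in absolute value, so the threshold 6 pi R + 1 in
  \<open>trap_small\<close> leaves |log |w|| >= 1.\<close>

lemma trap_denom_bound:
  fixes a :: real
  assumes \<tau>: "Im \<tau> > 0" and n: "n \<notin> trap_small a \<tau> R" and v: "norm v \<le> R"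
  shows "1 / 2 \<le> norm (trap_denom a \<tau> v n)"
    "norm (qpow \<tau> (a + 3 * real_of_int n) * exp (6 * pi * \<i> * v)) / 2 \<le> norm (trap_denom a \<tau> v n)"
proof -
  let ?s = "- (2 * pi * Im \<tau> * (a + 3 * real_of_int n) + 6 * pi * Im v)"
  have "\<bar>6 * pi * Im v\<bar> \<le> 6 * pi * R"
    using abs_Im_le_cmod[of v] v by (simp add: abs_mult)
  moreover have "\<bar>2 * pi * Im \<tau> * (a + 3 * real_of_int n)\<bar> \<ge> 6 * pi * R + 1"
    using n \<tau> by (simp add: trap_small_def abs_mult)
  ultimately have "\<bar>?s\<bar> \<ge> 1" by linarith
  from norm_one_minus_lower_bound[OF norm_qpow_mult_exp this]
  show "1 / 2 \<le> norm (trap_denom a \<tau> v n)"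
    "norm (qpow \<tau> (a + 3 * real_of_int n) * exp (6 * pi * \<i> * v)) / 2 \<le> norm (trap_denom a \<tau> v n)"
    by (simp_all add: trap_denom_def)
qed

lemma trap_term_norm_le:
  assumes "Im \<tau> > 0" "n \<notin> trap_small a \<tau> R" "norm v \<le> R"
  shows "norm (trap_term a b \<tau> u v n) \<le> 2 * norm (trap_numer a b \<tau> u n)"
proof -
  have 1: "1 / 2 \<le> norm (trap_denom a \<tau> v n)" by (rule trap_denom_bound[OF assms])
  then have "norm (trap_numer a b \<tau> u n) / norm (trap_denom a \<tau> v n) \<le> norm (trap_numer a b \<tau> u n) / (1 / 2)"
    by (intro divide_left_mono) auto
  then show ?thesis by (simp add: trap_term_eq norm_divide)
qed

text \<open>A vanishing denominator can occur only at one of the finitely many indices in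
  \<open>trap_small\<close>, where the term is 0 by the convention x / 0 = 0. Hence the claim covers
  the poles as well.\<close>

lemma trap_term_summable:
  assumes \<tau>: "Im \<tau> > 0"
  shows "trap_term a b \<tau> u v summable_on A"
proof -
  define R where "R = max (norm u) (norm v)"
  let ?F = "trap_small a \<tau> R"
  obtain K where K: "K \<ge> 0" "\<And>u n. norm u \<le> R \<Longrightarrow>
    (1 + \<bar>a + 3 * real_of_int n\<bar>) * norm (trap_numer a b \<tau> u n) \<le> K * exp (- \<bar>real_of_int n\<bar>)"
    using trap_numer_bound[OF \<tau>] by blast
  have M: "(\<lambda>n. 2 * K * exp (- \<bar>real_of_int n\<bar>)) summable_on - ?F"
    by (intro summable_on_cmult_right summable_on_subset_banach[OF summable_exp_neg_abs_int]) auto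
  have "trap_term a b \<tau> u v summable_on - ?F"
  proof (rule abs_summable_summable, rule summable_on_comparison_test[OF M])
    fix n assume n: "n \<in> - ?F"
    have "norm (trap_numer a b \<tau> u n) \<le> (1 + \<bar>a + 3 * real_of_int n\<bar>) * norm (trap_numer a b \<tau> u n)"
      by (simp add: distrib_right)
    also have "\<dots> \<le> K * exp (- \<bar>real_of_int n\<bar>)" by (rule K(2)) (simp add: R_def)
    finally show "norm (trap_term a b \<tau> u v n) \<le> 2 * K * exp (- \<bar>real_of_int n\<bar>)"
      using trap_term_norm_le[OF \<tau>, of n a R v b u] n by (simp add: R_def)
  qed auto
  with summable_on_finite[OF finite_trap_small[OF \<tau>]]
  have "trap_term a b \<tau> u v summable_on (?F \<union> - ?F)"
    by (rule summable_on_union)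
  then show ?thesis by (rule summable_on_subset_banach) auto
qed

section \<open>Partial derivatives of numerators, denominators and summands\<close>

lemma trap_numer_has_derivative:
  fixes a :: real
  shows "((\<lambda>(u, v). trap_numer a b \<tau> u n) has_derivative
    (\<lambda>(h, k). (2 * pi * \<i> * (a + 3 * n) * trap_numer a b \<tau> (fst z) n) * h + 0 * k)) (at z)"
  unfolding trap_numer_def case_prod_unfold
  by (rule has_derivative_eq_rhs, (rule derivative_intros)+) (simp add: fun_eq_iff)

lemma trap_denom_has_derivative:
  fixes a :: real
  shows "((\<lambda>(u, v). trap_denom a \<tau> v n) has_derivative
    (\<lambda>(h, k). 0 * h + (- (6 * pi * \<i> * (qpow \<tau> (a + 3 * real_of_int n) * exp (6 * pi * \<i> * snd z)))) * k)) (at z)"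
  unfolding trap_denom_def case_prod_unfold
  by (rule has_derivative_eq_rhs, (rule derivative_intros)+) (simp add: fun_eq_iff)

text \<open>The v-derivative is written as the summand times 6 pi i w/(1 - w), so that the bound
  |w|/2 <= |1 - w| applies to it directly.\<close>

lemma trap_term_has_derivative:
  fixes a :: real
  assumes "trap_denom a \<tau> (snd z) n \<noteq> 0"
  shows "((\<lambda>(u, v). trap_term a b \<tau> u v n) has_derivative
    (\<lambda>(h, k). (2 * pi * \<i> * (a + 3 * n) * trap_term a b \<tau> (fst z) (snd z) n) * h +
      (6 * pi * \<i> * trap_term a b \<tau> (fst z) (snd z) n *
        (qpow \<tau> (a + 3 * real_of_int n) * exp (6 * pi * \<i> * snd z) / trap_denom a \<tau> (snd z) n)) * k)) (at z)"
proof -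
  have "((\<lambda>w. (case w of (u, v) \<Rightarrow> trap_numer a b \<tau> u n) / (case w of (u, v) \<Rightarrow> trap_denom a \<tau> v n))
     has_derivative
    (\<lambda>(h, k). (2 * pi * \<i> * (a + 3 * n) * trap_term a b \<tau> (fst z) (snd z) n) * h +
      (6 * pi * \<i> * trap_term a b \<tau> (fst z) (snd z) n *
        (qpow \<tau> (a + 3 * real_of_int n) * exp (6 * pi * \<i> * snd z) / trap_denom a \<tau> (snd z) n)) * k)) (at z)"
    by (rule has_derivative_eq_rhs[OF has_derivative_divide'
          [OF trap_numer_has_derivative trap_denom_has_derivative]])
      (use assms in \<open>auto simp: fun_eq_iff trap_term_eq case_prod_unfold field_simps\<close>)
  then show ?thesis by (simp add: trap_term_eq case_prod_unfold)
qed

lemma holomorphic2_on_trap_numer: "holomorphic2_on (\<lambda>(u, v). trap_numer a b \<tau> u n) D"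
  by (rule holomorphic2_onI, rule trap_numer_has_derivative)

lemma holomorphic2_on_trap_denom: "holomorphic2_on (\<lambda>(u, v). trap_denom a \<tau> v n) D"
  by (rule holomorphic2_onI, rule trap_denom_has_derivative)

subsection \<open>Meromorphy of the trapezoid function\<close>

lemma holomorphic2_on_trap_tail:
  assumes \<tau>: "Im \<tau> > 0"
    and W: "open W" "convex W" "\<And>z. z \<in> W \<Longrightarrow> norm z \<le> R"
  shows "holomorphic2_on (\<lambda>(u, v). \<Sum>\<^sub>\<infinity>n\<in>- trap_small a \<tau> R. trap_term a b \<tau> u v n) W"
proof -
  let ?F = "trap_small a \<tau> R"
  \<comment> \<open>Padding with zeros turns the tail into a sum over all integers, as
    \<open>holomorphic2_on_infsum\<close> requires.\<close>
  define f where "f n = (\<lambda>(u, v). if n \<in> ?F then 0 else trap_term a b \<tau> u v n)" for n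
  define A where "A n z = (if n \<in> ?F then 0 else
    2 * pi * \<i> * (a + 3 * n) * trap_term a b \<tau> (fst z) (snd z) n)" for n z
  define B where "B n z = (if n \<in> ?F then 0 else 6 * pi * \<i> * trap_term a b \<tau> (fst z) (snd z) n *
        (qpow \<tau> (a + 3 * real_of_int n) * exp (6 * pi * \<i> * snd z) / trap_denom a \<tau> (snd z) n))" for n z
  obtain K where K: "K \<ge> 0" "\<And>u n. norm u \<le> R \<Longrightarrow>
    (1 + \<bar>a + 3 * real_of_int n\<bar>) * norm (trap_numer a b \<tau> u n) \<le> K * exp (- \<bar>real_of_int n\<bar>)"
    using trap_numer_bound[OF \<tau>] by blast
  \<comment> \<open>A summand is at most 2 K exp (-|n|) = M n / (12 pi). The largest demand comes
    from the v-derivative, with a further factor 6 pi and the bound 2 for |w/(1 - w)|.\<close>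
  define M where "M n = 24 * pi * (K * exp (- \<bar>real_of_int n\<bar>))" for n
  have M0: "M n \<ge> 0" for n using K(1) by (simp add: M_def)
  have uv: "norm (fst z) \<le> R" "norm (snd z) \<le> R" if "z \<in> W" for z
    using W(3)[OF that] norm_fst_le[of "fst z" "snd z"] norm_snd_le[of "snd z" "fst z"] by auto
  have T: "(1 + \<bar>a + 3 * real_of_int n\<bar>) * norm (trap_term a b \<tau> (fst z) (snd z) n) \<le> M n / (12 * pi)"
    if "z \<in> W" "n \<notin> ?F" for n z
  proof -
    have "(1 + \<bar>a + 3 * real_of_int n\<bar>) * norm (trap_term a b \<tau> (fst z) (snd z) n)
      \<le> (1 + \<bar>a + 3 * real_of_int n\<bar>) * (2 * norm (trap_numer a b \<tau> (fst z) n))"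
      using trap_term_norm_le[OF \<tau> that(2) uv(2)[OF that(1)]] by (intro mult_left_mono) auto
    also have "\<dots> \<le> M n / (12 * pi)"
      using K(2)[OF uv(1)[OF that(1)], of n] by (simp add: M_def)
    finally show ?thesis .
  qed
  have T0: "norm (trap_term a b \<tau> (fst z) (snd z) n) \<le> M n / (12 * pi)"
    "\<bar>a + 3 * real_of_int n\<bar> * norm (trap_term a b \<tau> (fst z) (snd z) n) \<le> M n / (12 * pi)"
    if "z \<in> W" "n \<notin> ?F" for n z
  proof -
    have "0 \<le> \<bar>a + 3 * real_of_int n\<bar> * norm (trap_term a b \<tau> (fst z) (snd z) n)" by simp
    then show "norm (trap_term a b \<tau> (fst z) (snd z) n) \<le> M n / (12 * pi)"
      "\<bar>a + 3 * real_of_int n\<bar> * norm (trap_term a b \<tau> (fst z) (snd z) n) \<le> M n / (12 * pi)"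
      using T[OF that] norm_ge_zero[of "trap_term a b \<tau> (fst z) (snd z) n"]
      by (simp_all only: distrib_right)
  qed
  have "holomorphic2_on (\<lambda>z. \<Sum>\<^sub>\<infinity>n. f n z) W"
  proof (rule holomorphic2_on_infsum[OF W(1,2), where A = A and B = B and M = M])
    show "M summable_on UNIV"
      unfolding M_def by (intro summable_on_cmult_right summable_exp_neg_abs_int)
    fix n z assume z: "z \<in> W"
    have D: "1 / 2 \<le> norm (trap_denom a \<tau> (snd z) n)"
      "norm (qpow \<tau> (a + 3 * real_of_int n) * exp (6 * pi * \<i> * snd z)) / 2 \<le> norm (trap_denom a \<tau> (snd z) n)"
      if "n \<notin> ?F" using trap_denom_bound[OF \<tau> that uv(2)[OF z]] .
    show "(f n has_derivative (\<lambda>(h, k). A n z * h + B n z * k)) (at z)"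
    proof (cases "n \<in> ?F")
      case True
      then show ?thesis by (simp add: f_def A_def B_def case_prod_unfold)
    next
      case False
      then have "trap_denom a \<tau> (snd z) n \<noteq> 0" using D by auto
      from trap_term_has_derivative[OF this] False show ?thesis
        by (simp add: f_def A_def B_def)
    qed
    show "norm (f n z) \<le> M n"
    proof (cases "n \<in> ?F")
      case False
      then have "norm (f n z) \<le> M n / (12 * pi)"
        using T0(1)[OF z] by (simp add: f_def case_prod_unfold)
      also have "\<dots> \<le> M n / 1" using M0[of n] pi_gt3 by (intro divide_left_mono) auto
      finally show ?thesis by simp
    qed (use M0 in \<open>auto simp: f_def case_prod_unfold\<close>)
    show "norm (A n z) \<le> M n"
    proof (cases "n \<in> ?F")
      case False
      have "norm (complex_of_real a + 3 * of_int n) = \<bar>a + 3 * real_of_int n\<bar>"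
        using norm_of_real[of "a + 3 * real_of_int n", where 'a = complex] by simp
      then have "norm (A n z) = 2 * pi * (\<bar>a + 3 * real_of_int n\<bar> * norm (trap_term a b \<tau> (fst z) (snd z) n))"
        using False by (simp add: A_def norm_mult)
      also have "\<dots> \<le> 2 * pi * (M n / (12 * pi))"
        using T0(2)[OF z False] by (intro mult_left_mono) auto
      also have "\<dots> \<le> M n" using M0[of n] by simp
      finally show ?thesis .
    qed (use M0 in \<open>auto simp: A_def\<close>)
    show "norm (B n z) \<le> M n"
    proof (cases "n \<in> ?F")
      case False
      let ?w = "qpow \<tau> (a + 3 * real_of_int n) * exp (6 * pi * \<i> * snd z)"
      have "norm (?w / trap_denom a \<tau> (snd z) n) \<le> 2"
        using D[OF False] unfolding norm_divide by (simp add: divide_le_eq)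
      then have "6 * pi * norm (trap_term a b \<tau> (fst z) (snd z) n) * norm (?w / trap_denom a \<tau> (snd z) n)
        \<le> 6 * pi * (M n / (12 * pi)) * 2"
        using T0(1)[OF z False] M0[of n] by (intro mult_mono mult_left_mono) auto
      then show ?thesis using False by (simp add: B_def norm_mult norm_divide)
    qed (use M0 in \<open>auto simp: B_def\<close>)
  qed
  moreover have "(\<Sum>\<^sub>\<infinity>n. f n z) = (case z of (u, v) \<Rightarrow> \<Sum>\<^sub>\<infinity>n\<in>- ?F. trap_term a b \<tau> u v n)" for z
    unfolding f_def by (cases z) (auto intro!: infsum_cong_neutral)
  ultimately show ?thesis by simp
qed

text \<open>A zero needs |q^(a+3n) exp(6 pi i v)| = 1, which fixes Im v. This serves to find points
  where finitely many denominators are all nonzero.\<close>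

lemma trap_denom_eq_0_imp_Im:
  fixes a :: real
  assumes "trap_denom a \<tau> v n = 0"
  shows "Im v = - Im \<tau> * (a + 3 * real_of_int n) / 3"
proof -
  have "exp (- (2 * pi * Im \<tau> * (a + 3 * real_of_int n) + 6 * pi * Im v)) = 1"
    using norm_qpow_mult_exp[of \<tau> "a + 3 * n" v] assms by (simp add: trap_denom_def)
  then have "pi * (Im \<tau> * (a + 3 * real_of_int n) + 3 * Im v) = 0" by (simp add: algebra_simps)
  then show ?thesis by simp
qed

lemma meromorphic2_on_infsum_trap_term:
  assumes \<tau>: "Im \<tau> > 0"
  shows "meromorphic2_on (\<lambda>(u, v). \<Sum>\<^sub>\<infinity>n. trap_term a b \<tau> u v n) UNIV"
  unfolding meromorphic2_on_def
proof
  fix p :: "complex \<times> complex"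
  \<comment> \<open>This radius bounds every point of the unit ball around \<open>p\<close>, so one
    finite index set works on the whole ball.\<close>
  define R where "R = norm p + 1"
  define F where "F = trap_small a \<tau> R"
  have fin: "finite F" unfolding F_def by (rule finite_trap_small[OF \<tau>])
  let ?W = "ball p 1"
  define t where "t = (\<lambda>(u, v). \<Sum>\<^sub>\<infinity>n\<in>- F. trap_term a b \<tau> u v n)"
  define h where "h = (\<lambda>z :: complex \<times> complex. \<Prod>n\<in>F. (\<lambda>(u, v). trap_denom a \<tau> v n) z)"
  \<comment> \<open>The numerator obtained by bringing the finitely many exceptional summands and
    the holomorphic tail over the common denominator \<open>h\<close>.\<close>
  define g where "g = (\<lambda>z. (\<Sum>n\<in>F. (\<lambda>(u, v). trap_numer a b \<tau> u n) z *
      (\<Prod>m\<in>F - {n}. (\<lambda>(u, v). trap_denom a \<tau> v m) z)) + h z * t z)"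
  have R: "norm z \<le> R" if "z \<in> ?W" for z
    using that norm_triangle_ineq3[of p z] by (simp add: R_def dist_norm)
  have h: "holomorphic2_on h ?W"
    unfolding h_def by (intro holomorphic2_on_prod holomorphic2_on_trap_denom)
  have "holomorphic2_on t ?W"
    unfolding t_def F_def by (rule holomorphic2_on_trap_tail[OF \<tau>]) (use R in auto)
  with h have "holomorphic2_on g ?W"
    unfolding g_def
    by (intro holomorphic2_on_add holomorphic2_on_sum holomorphic2_on_mult holomorphic2_on_prod
        holomorphic2_on_trap_denom holomorphic2_on_trap_numer)
  moreover have "\<exists>z\<in>?W. h z \<noteq> 0"
  proof -
    obtain u v where p: "p = (u, v)" by (cases p)
    \<comment> \<open>Moving from v to v + i s, each denominator with index in \<open>F\<close> can
      vanish for at most one real s, so some s in (0,1) avoids them all.\<close>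
    let ?S = "(\<lambda>n. - Im \<tau> * (a + 3 * real_of_int n) / 3 - Im v) ` F"
    have "infinite ({0<..<1} - ?S)" using fin infinite_Ioo[of "0::real" 1] by simp
    then have "{0<..<1} - ?S \<noteq> {}" by (metis finite.emptyI)
    then obtain s where "s \<in> {0<..<1} - ?S" by blast
    then have s: "0 < s" "s < 1" "s \<notin> ?S" by simp_all
    have "trap_denom a \<tau> (v + \<i> * s) n \<noteq> 0" if "n \<in> F" for n
      using trap_denom_eq_0_imp_Im[of a \<tau> "v + \<i> * s" n] s(3) that by (auto simp: image_iff)
    then have "h (u, v + \<i> * s) \<noteq> 0" using fin by (simp add: h_def)
    moreover have "(u, v + \<i> * s) \<in> ?W"
      using s by (simp add: p dist_prod_def dist_norm norm_mult)
    ultimately show ?thesis by blast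
  qed
  moreover have "(\<lambda>(u, v). \<Sum>\<^sub>\<infinity>n. trap_term a b \<tau> u v n) z = g z / h z" if "h z \<noteq> 0" for z
  proof -
    obtain u v where z: "z = (u, v)" by (cases z)
    have nz: "trap_denom a \<tau> v n \<noteq> 0" if "n \<in> F" for n
      using \<open>h z \<noteq> 0\<close> fin that by (auto simp: h_def z)
    have "(\<Sum>\<^sub>\<infinity>n\<in>F \<union> - F. trap_term a b \<tau> u v n) =
        (\<Sum>\<^sub>\<infinity>n\<in>F. trap_term a b \<tau> u v n) + (\<Sum>\<^sub>\<infinity>n\<in>- F. trap_term a b \<tau> u v n)"
      by (intro infsum_Un_disjoint trap_term_summable[OF \<tau>]) auto
    then have eq: "(\<Sum>\<^sub>\<infinity>n. trap_term a b \<tau> u v n) = (\<Sum>n\<in>F. trap_term a b \<tau> u v n) + t z"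
      using fin by (simp add: t_def z)
    have "h z * trap_term a b \<tau> u v n = trap_numer a b \<tau> u n * (\<Prod>m\<in>F - {n}. trap_denom a \<tau> v m)"
      if "n \<in> F" for n
      using prod.remove[OF fin that, of "trap_denom a \<tau> v"] nz[OF that]
      by (simp add: h_def z trap_term_eq)
    then have "g z = h z * ((\<Sum>n\<in>F. trap_term a b \<tau> u v n) + t z)"
      by (simp add: g_def z distrib_left sum_distrib_left)
    then show ?thesis using that eq by (simp add: z)
  qed
  ultimately show "\<exists>W g h. open W \<and> connected W \<and> p \<in> W \<and> W \<subseteq> UNIV \<and>
        holomorphic2_on g W \<and> holomorphic2_on h W \<and> (\<exists>z\<in>W. h z \<noteq> 0) \<and>
        (\<forall>z\<in>W. h z \<noteq> 0 \<longrightarrow> (\<lambda>(u, v). \<Sum>\<^sub>\<infinity>n. trap_term a b \<tau> u v n) z = g z / h z)"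
    using h by - (rule exI[of _ ?W], rule exI[of _ g], rule exI[of _ h], simp)
qed

lemma meromorphic2_on_theta_trap:
  assumes "Im \<tau> > 0"
  shows "meromorphic2_on (\<lambda>(u, v). theta_trap a b (3 * \<tau>) (3 * u) (3 * v)) UNIV"
  using meromorphic2_on_mult_holomorphic[OF holomorphic2_on_exp_snd[of "2 * pi * \<i> * b"]
      meromorphic2_on_infsum_trap_term[OF assms, of a b]]
  by (simp add: theta_trap_def Let_def case_prod_unfold mult_ac)

subsection \<open>The reflection identity\<close>

text \<open>Changing the signs of a, b and n sends x = a + 3n to -x and preserves the quadratic
  exponent x (x + 2b) / 6. Replacing u by tau - u supplies the factor q^(-x) that matches the two
  denominators.\<close>

lemma trap_term_reflect:
  fixes a :: real
  assumes "trap_denom a \<tau> (- v) n \<noteq> 0" "trap_denom (- a) \<tau> v (- n) \<noteq> 0"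
  shows "trap_term a b \<tau> u (- v) n =
    - exp (- 2 * pi * \<i> * a / 3) * exp (6 * pi * \<i> * v) * trap_term (- a) (- b) \<tau> (\<tau> - u) v (- n)"
proof -
  define x where "x = a + 3 * real_of_int n"
  define Q where "Q = qpow \<tau> x"
  define E where "E = exp (6 * pi * \<i> * v)"
  define P where "P = qpow \<tau> (1 / 6 * x * (x + 2 * b))"
  define A where "A = exp (2 * pi * \<i> * a / 3)"
  have nz: "Q \<noteq> 0" "E \<noteq> 0" "A \<noteq> 0" by (simp_all add: Q_def qpow_def E_def A_def)
  have x: "- a + 3 * real_of_int (- n) = - x" "complex_of_real x = a + 3 * of_int n"
    by (simp_all add: x_def)
  have Qm: "qpow \<tau> (- x) = inverse Q" by (simp add: Q_def qpow_def exp_minus)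
  have Em: "exp (6 * pi * \<i> * - v) = inverse E" by (simp add: E_def exp_minus)
  have d1: "trap_denom a \<tau> (- v) n = 1 - Q * inverse E"
    unfolding trap_denom_def Em Q_def x_def ..
  have d2: "trap_denom (- a) \<tau> v (- n) = 1 - inverse Q * E"
    unfolding trap_denom_def x Qm E_def ..
  have n1: "trap_numer a b \<tau> u n = P * exp (2 * pi * \<i> * x * (u - 1 / 6))"
    unfolding trap_numer_def P_def x_def by (simp add: algebra_simps)
  have P2: "1 / 6 * (- a + 3 * real_of_int (- n)) * (- a + 2 * - b + 3 * real_of_int (- n)) =
      1 / 6 * x * (x + 2 * b)"
    by (simp add: x_def algebra_simps)
  \<comment> \<open>Since x/6 = -x/6 + x/3, the exponent gains 2 pi i x/3 = 2 pi i a/3 + 2 pi i n,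
    whose last part is a period of exp.\<close>
  have "exp (2 * pi * \<i> * (- x) * (\<tau> - u - 1 / 6)) =
      exp (- (2 * pi * \<i> * \<tau> * x) + 2 * pi * \<i> * x * (u - 1 / 6) + 2 * pi * \<i> * a / 3 + 2 * of_int n * pi * \<i>)"
    by (simp add: x(2) field_simps)
  also have "\<dots> = inverse Q * exp (2 * pi * \<i> * x * (u - 1 / 6)) * A"
    using exp_integer_2pi[of "of_int n"]
    unfolding exp_add by (simp add: A_def Q_def qpow_def exp_minus mult_ac)
  finally have e2: "exp (2 * pi * \<i> * (- x) * (\<tau> - u - 1 / 6)) =
    inverse Q * exp (2 * pi * \<i> * x * (u - 1 / 6)) * A" .
  have n2: "trap_numer (- a) (- b) \<tau> (\<tau> - u) (- n) =
    P * (inverse Q * exp (2 * pi * \<i> * x * (u - 1 / 6)) * A)"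
    unfolding trap_numer_def P2 e2[symmetric] P_def by (simp add: x(2) algebra_simps)
  have a: "exp (- 2 * pi * \<i> * a / 3) = inverse A"
    by (simp add: A_def flip: exp_minus)
  \<comment> \<open>Both denominators are unit multiples of Q - E, so their reciprocals differ by
    the factor -E/Q.\<close>
  have "1 - Q * inverse E = - inverse E * (Q - E)" "1 - inverse Q * E = inverse Q * (Q - E)"
    using nz by (simp_all add: right_diff_distrib)
  then have den: "inverse (1 - Q * inverse E) = - E * inverse Q * inverse (1 - inverse Q * E)"
    using nz by (simp add: inverse_mult_distrib)
  show ?thesis
    unfolding trap_term_eq n1 n2 d1 d2 a E_def[symmetric] unfolding divide_inverse den using \<open>A \<noteq> 0\<close> by simp
qed

text \<open>The identity of meromorphic functions is rendered as meromorphy of both sides together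
  with equality wherever no denominator vanishes, that is, off a locally finite family of lines v =
  const. Summability ensures that the infinite sums there are genuine ones and not default
  values.\<close>

theorem mainTheorem2:
  fixes \<tau> :: complex and a b :: real
  assumes "Im \<tau> > 0"
  shows "meromorphic2_on (\<lambda>(u, v). theta_trap a b (3 * \<tau>) (3 * u) (- 3 * v)) UNIV \<and>
    meromorphic2_on (\<lambda>(u, v). - exp (- 2 * pi * \<i> * a / 3) * exp (6 * pi * \<i> * v) *
      theta_trap (- a) (- b) (3 * \<tau>) (3 * (\<tau> - u)) (3 * v)) UNIV \<and>
    (\<forall>u v. (\<forall>n. trap_denom a \<tau> (- v) n \<noteq> 0) \<and> (\<forall>n. trap_denom (- a) \<tau> v n \<noteq> 0) \<longrightarrow>
      trap_term a b \<tau> u (- v) summable_on UNIV \<and>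
      trap_term (- a) (- b) \<tau> (\<tau> - u) v summable_on UNIV \<and>
      theta_trap a b (3 * \<tau>) (3 * u) (- 3 * v) =
        - exp (- 2 * pi * \<i> * a / 3) * exp (6 * pi * \<i> * v) *
          theta_trap (- a) (- b) (3 * \<tau>) (3 * (\<tau> - u)) (3 * v))"
proof (intro conjI allI impI)
  show "meromorphic2_on (\<lambda>(u, v). theta_trap a b (3 * \<tau>) (3 * u) (- 3 * v)) UNIV"
    using meromorphic2_on_affine[OF meromorphic2_on_theta_trap[OF assms, of a b],
        where s = 1 and t = "-1" and c = 0 and d = 0] by simp
  have "holomorphic2_on (\<lambda>z. - exp (- 2 * pi * \<i> * a / 3) * (case z of (u, v) \<Rightarrow> exp (6 * pi * \<i> * v))) UNIV"
    by (intro holomorphic2_on_mult holomorphic2_on_const holomorphic2_on_exp_snd)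
  from meromorphic2_on_mult_holomorphic[OF this
      meromorphic2_on_affine[OF meromorphic2_on_theta_trap[OF assms, of "- a" "- b"],
        where s = "-1" and t = 1 and c = \<tau> and d = 0]]
  show "meromorphic2_on (\<lambda>(u, v). - exp (- 2 * pi * \<i> * a / 3) * exp (6 * pi * \<i> * v) *
      theta_trap (- a) (- b) (3 * \<tau>) (3 * (\<tau> - u)) (3 * v)) UNIV"
    by (simp add: case_prod_unfold)
next
  fix u v
  show "trap_term a b \<tau> u (- v) summable_on UNIV"
    "trap_term (- a) (- b) \<tau> (\<tau> - u) v summable_on UNIV"
    by (rule trap_term_summable[OF assms])+
  assume nz: "(\<forall>n. trap_denom a \<tau> (- v) n \<noteq> 0) \<and> (\<forall>n. trap_denom (- a) \<tau> v n \<noteq> 0)"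
  let ?c = "- exp (- 2 * pi * \<i> * a / 3) * exp (6 * pi * \<i> * v)"
  have "(\<Sum>\<^sub>\<infinity>n. trap_term a b \<tau> u (- v) n) = (\<Sum>\<^sub>\<infinity>n. ?c * trap_term (- a) (- b) \<tau> (\<tau> - u) v (- n))"
    by (intro infsum_cong trap_term_reflect) (use nz in auto)
  also have "\<dots> = ?c * (\<Sum>\<^sub>\<infinity>n. trap_term (- a) (- b) \<tau> (\<tau> - u) v (- n))"
    by (rule infsum_cmult_right')
  \<comment> \<open>The reflection n -> -n permutes the integers.\<close>
  also have "(\<Sum>\<^sub>\<infinity>n. trap_term (- a) (- b) \<tau> (\<tau> - u) v (- n)) =
      (\<Sum>\<^sub>\<infinity>n. trap_term (- a) (- b) \<tau> (\<tau> - u) v n)"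
    by (rule infsum_reindex_bij_betw) (rule bij_uminus)
  finally have sums: "(\<Sum>\<^sub>\<infinity>n. trap_term a b \<tau> u (- v) n) =
      ?c * (\<Sum>\<^sub>\<infinity>n. trap_term (- a) (- b) \<tau> (\<tau> - u) v n)" .
  \<comment> \<open>Keeping 3 (tau - u) unexpanded lets this equation rescale the argument. The
    outer exponential factors agree because (-v) b = v (-b).\<close>
  have "3 * (\<tau> - u) / 3 = \<tau> - u" by simp
  with sums show "theta_trap a b (3 * \<tau>) (3 * u) (- 3 * v) =
        - exp (- 2 * pi * \<i> * a / 3) * exp (6 * pi * \<i> * v) *
          theta_trap (- a) (- b) (3 * \<tau>) (3 * (\<tau> - u)) (3 * v)"
    by (simp add: theta_trap_def Let_def del: right_diff_distrib_numeral)
qed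

end
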